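(* Let $A$ be an $A_\infty$-algebra over a field $\mathbb{K}$ and $m\ge2$. Suppose the Massey product of $\alpha_1,\dots,\alpha_m\in\mathrm{H}(A)$ is defined. Then for any $\gamma\in\mathrm{H}(A)$, the Massey product of $\overline{\alpha_1},\dots,\overline{\alpha_{m-1}},\bar b_2(\alpha_m,\gamma)$ is also defined, and $$\langle\overline{\alpha_1},\dots,\overline{\alpha_{m-1}},\bar b_2(\alpha_m,\gamma)\rangle\supset-\bar b_2(\langle\alpha_1,\dots,\alpha_m\rangle,\gamma).$$
   Context: $A_\infty$-algebra: a $\mathbb{Z}$- or $\mathbb{Z}_2$-graded $\mathbb{K}$-vector space $A$ with graded multilinear maps $b_n\colon A^{\otimes n}\to A$ ($n\ge1$) of degree $1$ such that for each $n\ge1$, $\sum_{r,t\ge0,\,s\ge1,\,r+s+t=n}b_{r+1+t}\circ(1^{\otimes r}\otimes b_s\otimes1^{\otimes t})=0$ (Koszul sign rule $(f\otimes g)(x\otimes y)=(-1)^{|g||x|}f(x)\otimes g(y)$). $\mathrm{H}(A)$ is the cohomology of $(A,b_1)$, and $\bar b_2$ is the operation on $\mathrm{H}(A)$ induced by $b_2$. A bar over an element denotes $\bar a=(-1)^{|a|}a$ for homogeneous $a$, extended linearly (also on $\mathrm{H}(A)$). $\mathrm{Mat}^{(m+1)}_+(A)$ is the space of strictly upper-triangular matrices $\mathbf{a}=(a_{ij})_{0\le i,j\le m}$ with entries in $A$. The product $\odot$ of matrices is $(\mathbf{a}\odot\mathbf{b})_{ij}=\sum_ka_{ik}\otimes b_{kj}$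 (no signs); $b_n$ acts component-wise on matrices with entries in $A^{\otimes n}$. For $\mathbf{a}\in\mathrm{Mat}^{(m+1)}_+(A)$, $\partial_{\mathbf{a}}\mathbf{a}=\sum_{n\ge1}b_n(\underbrace{\mathbf{a}\odot\cdots\odot\mathbf{a}}_n)$ (a finite sum), and $\mathbf{a}\approx\mathbf{a}'$ means $a_{ij}=a'_{ij}$ for all $(i,j)\ne(0,m)$. For $m\ge2$, $\mathbf{a}\in\mathrm{Mat}^{(m+1)}_+(A)$ is a defining system for $\alpha_1,\dots,\alpha_m\in\mathrm{H}(A)$ if $\partial_{\mathbf{a}}\mathbf{a}\approx0$ and each $\alpha_i$ is represented by the (then closed) element $a_{i-1,i}$. Put $\mu(\mathbf{a})=(\partial_{\mathbf{a}}\mathbf{a})_{0m}\in A$, which is $b_1$-closed. The Massey product of $\alpha_1,\dots,\alpha_m$ is defined if a defining system exists; $\langle\alpha_1,\dots,\alpha_m\rangle\subset\mathrm{H}(A)$ is the set of classes $[\mu(\mathbf{a})]$ over all defining systems $\mathbf{a}$ of $\alpha_1,\dots,\alpha_m$. *)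

theory Defs
  imports Complex_Main "HOL-Library.Z2"
begin

section \<open>Graded vector spaces\<close>

text \<open>
  The index set of a grading is a type of the following class: a ring with parity in which
  every element is an integer and which has characteristic \<open>2\<close> or \<open>0\<close>.  Up to isomorphism
  these are exactly \<open>\<int>\<close> (type \<^typ>\<open>int\<close>) and \<open>\<int>/2\<close> (type \<^typ>\<open>bit\<close>), so that a statement about
  an arbitrary type of this class covers \<open>\<int>\<close>-graded and \<open>\<int>/2\<close>-graded objects alike.
\<close>

class Z_or_Z2 = ring_parity +
  assumes all_Ints: "d \<in> \<int>"
    and char_2_or_0: "2 = 0 \<or> inj of_int"

instance int :: Z_or_Z2
proof
  show "d \<in> \<int>" for d :: int
    using Ints_of_int [of d, where 'a = int] by simp
qed (simp add: inj_def)

instance bit :: Z_or_Z2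
proof
  show "d \<in> \<int>" for d :: bit
    by (cases d) auto
qed simp

definition homogeneous_decomposition ::
    "('g \<Rightarrow> 'a::comm_monoid_add set) \<Rightarrow> 'a \<Rightarrow> ('g \<Rightarrow> 'a) \<Rightarrow> bool" where
  "homogeneous_decomposition gr x f \<longleftrightarrow>
     (\<forall>d. f d \<in> gr d) \<and> finite {d. f d \<noteq> 0} \<and> (\<Sum>d | f d \<noteq> 0. f d) = x"

locale graded_vector_space = vector_space scale
  for scale :: "'k::field \<Rightarrow> 'a::ab_group_add \<Rightarrow> 'a" +
  fixes gr :: "'g::Z_or_Z2 \<Rightarrow> 'a set"
  assumes subspace_gr: "subspace (gr d)"
    and direct_sum: "\<exists>!f. homogeneous_decomposition gr x f"

definition homogeneous_part :: "('g \<Rightarrow> 'a::comm_monoid_add set) \<Rightarrow> 'a \<Rightarrow> 'g \<Rightarrow> 'a" where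
  "homogeneous_part gr x = (THE f. homogeneous_decomposition gr x f)"

definition parity_sign :: "'g::Z_or_Z2 \<Rightarrow> 'a::ab_group_add \<Rightarrow> 'a" where
  "parity_sign d x = (if even d then x else - x)"

definition bar :: "('g::Z_or_Z2 \<Rightarrow> 'a::ab_group_add set) \<Rightarrow> 'a \<Rightarrow> 'a" where
  "bar gr x = (\<Sum>d | homogeneous_part gr x d \<noteq> 0. parity_sign d (homogeneous_part gr x d))"

section \<open>A-infinity algebras\<close>

text \<open>
  The operations are bundled into one function \<open>b\<close> on lists: \<open>b [x\<^sub>1, \<dots>, x\<^sub>n]\<close> is
  \<open>b\<^sub>n (x\<^sub>1 \<otimes> \<dots> \<otimes> x\<^sub>n)\<close>; the value \<open>b []\<close> is irrelevant.  In the relations, \<open>t = n - r - s\<close>, and since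
  every \<open>b\<^sub>s\<close> has degree \<open>1\<close> the Koszul rule gives the sign \<open>(-1)\<close> to the power
  \<open>\<bar>x\<^sub>1\<bar> + \<dots> + \<bar>x\<^sub>r\<bar>\<close>.
\<close>

locale a_infinity_algebra = graded_vector_space scale gr
  for scale :: "'k::field \<Rightarrow> 'a::ab_group_add \<Rightarrow> 'a"
    and gr :: "'g::Z_or_Z2 \<Rightarrow> 'a set" +
  fixes b :: "'a list \<Rightarrow> 'a"
  assumes multilinear: "Vector_Spaces.linear scale scale (\<lambda>x. b (xs @ x # ys))"
    and degree_one:
      "\<lbrakk>xs \<noteq> []; list_all2 (\<lambda>x d. x \<in> gr d) xs ds\<rbrakk> \<Longrightarrow> b xs \<in> gr (sum_list ds + 1)"
    and a_infinity_relation: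
      "\<lbrakk>xs \<noteq> []; list_all2 (\<lambda>x d. x \<in> gr d) xs ds\<rbrakk> \<Longrightarrow>
        (\<Sum>r<length xs. \<Sum>s=1..length xs - r.
           parity_sign (sum_list (take r ds))
             (b (take r xs @ b (take s (drop r xs)) # drop (r + s) xs))) = 0"

section \<open>Cohomology\<close>

definition cocycles :: "('a::ab_group_add list \<Rightarrow> 'a) \<Rightarrow> 'a set" where
  "cocycles b = {x. b [x] = 0}"

definition cohomologous :: "('a::ab_group_add list \<Rightarrow> 'a) \<Rightarrow> ('a \<times> 'a) set" where
  "cohomologous b =
     {(x, y). x \<in> cocycles b \<and> y \<in> cocycles b \<and> x - y \<in> range (\<lambda>z. b [z])}"

definition cohomology :: "('a::ab_group_add list \<Rightarrow> 'a) \<Rightarrow> 'a set set" where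
  "cohomology b = cocycles b // cohomologous b"

definition coh_class :: "('a::ab_group_add list \<Rightarrow> 'a) \<Rightarrow> 'a \<Rightarrow> 'a set" where
  "coh_class b x = cohomologous b `` {x}"

text \<open>
  Operations on cohomology are induced from operations on representatives.  The union is over
  equal classes, see the lemmas \<open>coh_b2_coh_class\<close>, \<open>coh_bar_coh_class\<close> and \<open>coh_uminus_coh_class\<close>
  below.
\<close>

definition coh_b2 :: "('a::ab_group_add list \<Rightarrow> 'a) \<Rightarrow> 'a set \<Rightarrow> 'a set \<Rightarrow> 'a set" where
  "coh_b2 b \<alpha> \<beta> = (\<Union>x\<in>\<alpha>. \<Union>y\<in>\<beta>. coh_class b (b [x, y]))"

definition coh_bar ::
    "('g::Z_or_Z2 \<Rightarrow> 'a set) \<Rightarrow> ('a::ab_group_add list \<Rightarrow> 'a) \<Rightarrow> 'a set \<Rightarrow> 'a set" where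
  "coh_bar gr b \<alpha> = (\<Union>x\<in>\<alpha>. coh_class b (bar gr x))"

definition coh_uminus :: "('a::ab_group_add list \<Rightarrow> 'a) \<Rightarrow> 'a set \<Rightarrow> 'a set" where
  "coh_uminus b \<alpha> = (\<Union>x\<in>\<alpha>. coh_class b (- x))"

section \<open>Massey products\<close>

text \<open>Matrices with index set \<open>{0..m}\<close> are functions that vanish outside of it.\<close>

definition strictly_upper :: "nat \<Rightarrow> (nat \<Rightarrow> nat \<Rightarrow> 'a::zero) set" where
  "strictly_upper m = {a. \<forall>i j. \<not> (i < j \<and> j \<le> m) \<longrightarrow> a i j = 0}"

text \<open>
  The \<open>(i, j)\<close> entry of \<open>b\<^sub>n (a \<odot> \<dots> \<odot> a)\<close>.  The \<open>(i, j)\<close> entry of the \<open>n\<close>-fold product is the sum of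
  \<open>a i k\<^sub>1 \<otimes> a k\<^sub>1 k\<^sub>2 \<otimes> \<dots> \<otimes> a k\<^sub>n\<^sub>-\<^sub>1 j\<close> over all lists \<open>ks\<close> of \<open>n - 1\<close> intermediate indices.
\<close>

definition b_odot_power ::
    "('a::ab_group_add list \<Rightarrow> 'a) \<Rightarrow> nat \<Rightarrow> nat \<Rightarrow> (nat \<Rightarrow> nat \<Rightarrow> 'a) \<Rightarrow> nat \<Rightarrow> nat \<Rightarrow> 'a" where
  "b_odot_power b m n a i j =
     (\<Sum>ks | set ks \<subseteq> {0..m} \<and> length ks = n - 1. b (map2 a (i # ks) (ks @ [j])))"

text \<open>
  For strictly upper triangular \<open>a\<close> the terms with \<open>n > m\<close> vanish, see the lemma
  \<open>b_odot_power_eq_0\<close> below.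
\<close>

definition boundary ::
    "('a::ab_group_add list \<Rightarrow> 'a) \<Rightarrow> nat \<Rightarrow> (nat \<Rightarrow> nat \<Rightarrow> 'a) \<Rightarrow> nat \<Rightarrow> nat \<Rightarrow> 'a" where
  "boundary b m a i j = (\<Sum>n=1..m. b_odot_power b m n a i j)"

definition eq_off_corner :: "nat \<Rightarrow> (nat \<Rightarrow> nat \<Rightarrow> 'a) \<Rightarrow> (nat \<Rightarrow> nat \<Rightarrow> 'a) \<Rightarrow> bool" where
  "eq_off_corner m a a' \<longleftrightarrow> (\<forall>i\<le>m. \<forall>j\<le>m. (i, j) \<noteq> (0, m) \<longrightarrow> a i j = a' i j)"

text \<open>The classes \<open>\<alpha>\<^sub>1, \<dots>, \<alpha>\<^sub>m\<close> are given by a function of which only these values matter.\<close>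

definition defining_system ::
    "('a::ab_group_add list \<Rightarrow> 'a) \<Rightarrow> nat \<Rightarrow> (nat \<Rightarrow> 'a set) \<Rightarrow> (nat \<Rightarrow> nat \<Rightarrow> 'a) \<Rightarrow> bool" where
  "defining_system b m \<alpha> a \<longleftrightarrow>
     a \<in> strictly_upper m \<and> eq_off_corner m (boundary b m a) (\<lambda>i j. 0) \<and>
     (\<forall>i\<in>{1..m}. \<alpha> i = coh_class b (a (i - 1) i))"

definition \<mu> :: "('a::ab_group_add list \<Rightarrow> 'a) \<Rightarrow> nat \<Rightarrow> (nat \<Rightarrow> nat \<Rightarrow> 'a) \<Rightarrow> 'a" where
  "\<mu> b m a = boundary b m a 0 m"

definition massey_defined ::
    "('a::ab_group_add list \<Rightarrow> 'a) \<Rightarrow> nat \<Rightarrow> (nat \<Rightarrow> 'a set) \<Rightarrow> bool" where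
  "massey_defined b m \<alpha> \<longleftrightarrow> (\<exists>a. defining_system b m \<alpha> a)"

definition massey_product ::
    "('a::ab_group_add list \<Rightarrow> 'a) \<Rightarrow> nat \<Rightarrow> (nat \<Rightarrow> 'a set) \<Rightarrow> 'a set set" where
  "massey_product b m \<alpha> = {coh_class b (\<mu> b m a) |a. defining_system b m \<alpha> a}"

section \<open>Well-definedness\<close>

context graded_vector_space
begin

lemma homogeneous_decomposition_part:
  "homogeneous_decomposition gr x (homogeneous_part gr x)"
  unfolding homogeneous_part_def by (rule theI' [OF direct_sum])

lemma homogeneous_part_unique:
  "homogeneous_decomposition gr x f \<Longrightarrow> homogeneous_part gr x = f"
  using direct_sum homogeneous_decomposition_part by blast

lemma part_in_gr: "homogeneous_part gr x d \<in> gr d"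
  and finite_part: "finite {d. homogeneous_part gr x d \<noteq> 0}"
  and sum_part: "(\<Sum>d | homogeneous_part gr x d \<noteq> 0. homogeneous_part gr x d) = x"
  using homogeneous_decomposition_part [of x] by (auto simp: homogeneous_decomposition_def)

lemma homogeneous_part_sum:
  assumes "finite S" "\<And>d. d \<in> S \<Longrightarrow> f d \<in> gr d" "\<And>d. d \<notin> S \<Longrightarrow> f d = 0"
  shows "homogeneous_part gr (\<Sum>d\<in>S. f d) = f"
proof (rule homogeneous_part_unique)
  have "{d. f d \<noteq> 0} \<subseteq> S"
    using assms(3) by blast
  moreover have "f d \<in> gr d" for d
    using assms(2,3) subspace_0 [OF subspace_gr] by (cases "d \<in> S") auto
  ultimately show "homogeneous_decomposition gr (\<Sum>d\<in>S. f d) f"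
    unfolding homogeneous_decomposition_def
    using assms(1) by (auto intro: finite_subset intro!: sum.mono_neutral_left)
qed

lemma bar_sum:
  assumes "finite S" "\<And>d. d \<in> S \<Longrightarrow> f d \<in> gr d" "\<And>d. d \<notin> S \<Longrightarrow> f d = 0"
  shows "bar gr (\<Sum>d\<in>S. f d) = (\<Sum>d\<in>S. parity_sign d (f d))"
proof -
  have "{d. f d \<noteq> 0} \<subseteq> S"
    using assms(3) by blast
  moreover have "homogeneous_part gr (sum f S) = f"
    using assms by (rule homogeneous_part_sum)
  ultimately show ?thesis
    unfolding bar_def
    using assms(1) by (auto simp: parity_sign_def intro!: sum.mono_neutral_left split: if_splits)
qed

lemma bar_homogeneous: "x \<in> gr d \<Longrightarrow> bar gr x = parity_sign d x"
  using bar_sum [of "{d}" "\<lambda>e. if e = d then x else 0"] by simp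

lemma bar_add: "bar gr (x + y) = bar gr x + bar gr y"
proof -
  define S where "S = {d. homogeneous_part gr x d \<noteq> 0} \<union> {d. homogeneous_part gr y d \<noteq> 0}"
  have S: "finite S"
    unfolding S_def by (intro finite_UnI finite_part)
  have part: "(\<Sum>d\<in>S. homogeneous_part gr x d) = x" "(\<Sum>d\<in>S. homogeneous_part gr y d) = y"
    by (rule trans [OF sum.mono_neutral_right [OF S] sum_part]; auto simp: S_def)+
  have bar_part: "bar gr x = (\<Sum>d\<in>S. parity_sign d (homogeneous_part gr x d))"
    "bar gr y = (\<Sum>d\<in>S. parity_sign d (homogeneous_part gr y d))"
    unfolding bar_def using S
    by (auto simp: S_def parity_sign_def intro!: sum.mono_neutral_left split: if_splits)
  have "bar gr (x + y) = bar gr (\<Sum>d\<in>S. homogeneous_part gr x d + homogeneous_part gr y d)"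
    by (simp add: sum.distrib part)
  also have "\<dots> = (\<Sum>d\<in>S. parity_sign d (homogeneous_part gr x d + homogeneous_part gr y d))"
    by (rule bar_sum) (auto simp: S_def finite_part intro: subspace_add [OF subspace_gr] part_in_gr)
  also have "\<dots> = bar gr x + bar gr y"
    unfolding bar_part sum.distrib [symmetric]
    by (auto simp: parity_sign_def intro!: sum.cong)
  finally show ?thesis .
qed

lemma bar_0 [simp]: "bar gr 0 = 0"
  using bar_add [of 0 0] by simp

lemma bar_minus: "bar gr (- x) = - bar gr x"
  using bar_add [of x "- x"] by (simp add: eq_neg_iff_add_eq_0 add.commute)

lemma bar_diff: "bar gr (x - y) = bar gr x - bar gr y"
  using bar_add [of x "- y"] by (simp add: bar_minus)

lemma bar_scale: "bar gr (scale c x) = scale c (bar gr x)"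
proof -
  let ?S = "{d. homogeneous_part gr x d \<noteq> 0}"
  have "bar gr (scale c x) = bar gr (\<Sum>d\<in>?S. scale c (homogeneous_part gr x d))"
    by (simp add: sum_part flip: scale_sum_right)
  also have "\<dots> = (\<Sum>d\<in>?S. parity_sign d (scale c (homogeneous_part gr x d)))"
    by (rule bar_sum) (auto simp: finite_part intro: subspace_scale [OF subspace_gr] part_in_gr)
  also have "\<dots> = scale c (bar gr x)"
    unfolding bar_def scale_sum_right by (auto simp: parity_sign_def intro!: sum.cong)
  finally show ?thesis .
qed

lemma additive_eqI:
  fixes f g :: "'a \<Rightarrow> 'a"
  assumes "\<And>x y. f (x + y) = f x + f y" "\<And>x y. g (x + y) = g x + g y"
    and "\<And>d x. x \<in> gr d \<Longrightarrow> f x = g x"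
  shows "f x = g x"
proof -
  have *: "f 0 = 0" "g 0 = 0"
    using assms(1) [of 0 0] assms(2) [of 0 0] by simp_all
  have "f (\<Sum>d\<in>S. homogeneous_part gr x d) = g (\<Sum>d\<in>S. homogeneous_part gr x d)"
    if "finite S" for S
    using that by induction (simp_all add: * assms(1,2) assms(3) [OF part_in_gr])
  then show ?thesis
    using sum_part [of x] finite_part [of x] by metis
qed

end

context a_infinity_algebra
begin

lemma b_add: "b (xs @ (x + y) # ys) = b (xs @ x # ys) + b (xs @ y # ys)"
  using module_hom.add [OF Vector_Spaces.linear.axioms(3) [OF multilinear]] .

lemma b_zero: "b (xs @ 0 # ys) = 0"
  using b_add [of xs 0 0 ys] by simp

lemma b1_add: "b [x + y] = b [x] + b [y]"
  and b2_add_left: "b [x + y, z] = b [x, z] + b [y, z]"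
  and b2_add_right: "b [z, x + y] = b [z, x] + b [z, y]"
  using b_add [of "[]" x y "[]"] b_add [of "[]" x y "[z]"] b_add [of "[z]" x y "[]"] by simp_all

lemma b1_zero: "b [0] = 0" and b2_zero_left: "b [0, x] = 0" and b2_zero_right: "b [x, 0] = 0"
  using b_zero [of "[]" "[]"] b_zero [of "[]" "[x]"] b_zero [of "[x]" "[]"] by simp_all

lemma b_minus: "b (xs @ (- x) # ys) = - b (xs @ x # ys)"
  by (rule minus_unique [symmetric]) (simp add: b_zero flip: b_add)

lemma b1_minus: "b [- x] = - b [x]"
  and b2_minus_left: "b [- x, y] = - b [x, y]"
  and b2_minus_right: "b [y, - x] = - b [y, x]"
  using b_minus [of "[]" x "[]"] b_minus [of "[]" x "[y]"] b_minus [of "[y]" x "[]"] by simp_all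

lemma b1_b1: "b [b [x]] = 0"
proof (rule additive_eqI [where x = x and f = "\<lambda>x. b [b [x]]" and g = "\<lambda>_. 0"])
  fix d x assume "x \<in> gr d"
  then show "b [b [x]] = 0"
    using a_infinity_relation [of "[x]" "[d]"] by (simp add: parity_sign_def)
qed (simp_all add: b1_add)

lemma b1_bar: "b [bar gr x] = - bar gr (b [x])"
proof (rule additive_eqI [where x = x and f = "\<lambda>x. b [bar gr x]" and g = "\<lambda>x. - bar gr (b [x])"])
  fix d x assume "x \<in> gr d"
  moreover from this have "b [x] \<in> gr (d + 1)"
    using degree_one [of "[x]" "[d]"] by simp
  ultimately show "b [bar gr x] = - bar gr (b [x])"
    by (simp add: bar_homogeneous parity_sign_def b1_minus)
qed (simp_all add: bar_add b1_add)

lemma Leibniz: "b [b [x, y]] + b [b [x], y] + b [bar gr x, b [y]] = 0"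
proof (rule additive_eqI [where x = x and f = "\<lambda>x. b [b [x, y]] + b [b [x], y] + b [bar gr x, b [y]]" and g = "\<lambda>_. 0"])
  fix d x assume x: "x \<in> gr d"
  show "b [b [x, y]] + b [b [x], y] + b [bar gr x, b [y]] = 0"
  proof (rule additive_eqI [where x = y and f = "\<lambda>y. b [b [x, y]] + b [b [x], y] + b [bar gr x, b [y]]" and g = "\<lambda>_. 0"])
    fix e y assume y: "y \<in> gr e"
    have sums: "(\<Sum>r<length [x, y]. f r) = f 0 + f 1" "(\<Sum>s=1..length [x, y] - 0. h s) = h 1 + h 2"
      "(\<Sum>s=1..length [x, y] - 1. h s) = h 1" for f h :: "nat \<Rightarrow> 'a"
      by (simp_all add: numeral_2_eq_2)
    have "b [b [x], y] + b [b [x, y]] + parity_sign d (b [x, b [y]]) = 0"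
      using a_infinity_relation [of "[x, y]" "[d, e]"] x y
      unfolding sums by (simp add: parity_sign_def)
    then show "b [b [x, y]] + b [b [x], y] + b [bar gr x, b [y]] = 0"
      using x by (simp add: parity_sign_def bar_homogeneous b2_minus_left add.commute split: if_splits)
  qed (simp_all add: b1_add b2_add_left b2_add_right)
qed (simp_all add: b1_add b2_add_left b2_add_right bar_add)

lemma equiv_cohomologous: "equiv (cocycles b) (cohomologous b)"
proof (rule equivI)
  show "cohomologous b \<subseteq> cocycles b \<times> cocycles b"
    by (auto simp: cohomologous_def)
  show "refl_on (cocycles b) (cohomologous b)"
    by (auto simp: refl_on_def cohomologous_def intro!: range_eqI [of _ _ 0] simp: b1_zero)
  show "sym (cohomologous b)"
  proof (rule symI)
    fix x y assume "(x, y) \<in> cohomologous b"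
    then have xy: "x \<in> cocycles b" "y \<in> cocycles b" and "x - y \<in> range (\<lambda>z. b [z])"
      by (simp_all add: cohomologous_def)
    then obtain u where u: "x - y = b [u]"
      by blast
    have "y - x = b [- u]"
      unfolding b1_minus u [symmetric] by simp
    with xy show "(y, x) \<in> cohomologous b"
      by (simp add: cohomologous_def)
  qed
  show "trans (cohomologous b)"
  proof (rule transI)
    fix x y z assume "(x, y) \<in> cohomologous b" "(y, z) \<in> cohomologous b"
    then have xz: "x \<in> cocycles b" "z \<in> cocycles b"
      and "x - y \<in> range (\<lambda>z. b [z])" "y - z \<in> range (\<lambda>z. b [z])"
      by (simp_all add: cohomologous_def)
    then obtain u v where uv: "x - y = b [u]" "y - z = b [v]"
      by blast
    have "x - z = b [u + v]"
      unfolding b1_add uv [symmetric] by simp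
    with xz show "(x, z) \<in> cohomologous b"
      by (simp add: cohomologous_def)
  qed
qed

lemma coh_class_in_cohomology: "x \<in> cocycles b \<Longrightarrow> coh_class b x \<in> cohomology b"
  by (simp add: coh_class_def cohomology_def quotientI)

lemma coh_class_eq_iff:
  "\<lbrakk>x \<in> cocycles b; y \<in> cocycles b\<rbrakk> \<Longrightarrow>
    coh_class b x = coh_class b y \<longleftrightarrow> x - y \<in> range (\<lambda>z. b [z])"
  by (subst coh_class_def, subst coh_class_def, subst eq_equiv_class_iff [OF equiv_cohomologous])
    (simp_all add: cohomologous_def)

lemma coh_class_memD:
  assumes "y \<in> coh_class b x"
  shows "x \<in> cocycles b" "y \<in> cocycles b" "\<exists>z. y = x + b [z]"
proof -
  obtain z where "x \<in> cocycles b" "y \<in> cocycles b" "x - y = b [z]"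
    using assms by (auto simp: coh_class_def cohomologous_def)
  then show "x \<in> cocycles b" "y \<in> cocycles b" "\<exists>z. y = x + b [z]"
    by (auto simp: algebra_simps b1_minus intro!: exI [of _ "- z"])
qed

lemma coh_class_self: "x \<in> cocycles b \<Longrightarrow> x \<in> coh_class b x"
  using equiv_class_self [OF equiv_cohomologous] by (simp add: coh_class_def)

lemma coh_class_add_exact: "x \<in> cocycles b \<Longrightarrow> coh_class b (x + b [z]) = coh_class b x"
  by (subst coh_class_eq_iff) (auto simp: cocycles_def b1_add b1_b1)

lemma b2_cocycle: "\<lbrakk>x \<in> cocycles b; y \<in> cocycles b\<rbrakk> \<Longrightarrow> b [x, y] \<in> cocycles b"
  using Leibniz [of x y] by (simp add: cocycles_def b2_zero_left b2_zero_right)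

lemma bar_cocycle: "x \<in> cocycles b \<Longrightarrow> bar gr x \<in> cocycles b"
  by (simp add: cocycles_def b1_bar)

lemma bar_bar: "bar gr (bar gr x) = x"
  by (rule additive_eqI [where g = "\<lambda>x. x"])
    (auto simp: bar_add bar_homogeneous parity_sign_def bar_minus)

lemma coh_b2_coh_class:
  assumes "x \<in> cocycles b" "y \<in> cocycles b"
  shows "coh_b2 b (coh_class b x) (coh_class b y) = coh_class b (b [x, y])"
proof -
  have "coh_class b (b [x', y']) = coh_class b (b [x, y])"
    if x': "x' \<in> coh_class b x" and y': "y' \<in> coh_class b y" for x' y'
  proof -
    obtain u v where u: "x' = x + b [u]" and v: "y' = y + b [v]"
      using coh_class_memD(3) [OF x'] coh_class_memD(3) [OF y'] by blast
    have c: "x' \<in> cocycles b"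
      using coh_class_memD(2) [OF x'] .
    have "b [x', y'] = b [x', y] + b [x', b [v]]"
      by (simp add: v b2_add_right)
    also have "b [x', b [v]] = b [- b [bar gr x', v]]"
      using Leibniz [of "bar gr x'" v] c bar_cocycle [OF c]
      by (simp add: cocycles_def bar_bar b2_zero_left b1_minus eq_neg_iff_add_eq_0 add.commute)
    also have "b [x', y] = b [x, y] + b [- b [u, y]]"
      using Leibniz [of u y] assms
      by (simp add: cocycles_def u b2_add_left b2_zero_right b1_minus eq_neg_iff_add_eq_0 add.commute)
    finally have "b [x', y'] = b [x, y] + b [- b [u, y] - b [bar gr x', v]]"
      using b1_add [of "- b [u, y]" "- b [bar gr x', v]"] by (simp add: add.assoc)
    then show ?thesis
      using coh_class_add_exact [OF b2_cocycle [OF assms]] by simp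
  qed
  moreover have "coh_class b x \<noteq> {}" "coh_class b y \<noteq> {}"
    using coh_class_self assms by blast+
  ultimately show ?thesis
    unfolding coh_b2_def by (intro SUP_eq_const)
qed

lemma coh_bar_coh_class:
  assumes "x \<in> cocycles b"
  shows "coh_bar gr b (coh_class b x) = coh_class b (bar gr x)"
proof -
  have "coh_class b (bar gr x') = coh_class b (bar gr x)" if x': "x' \<in> coh_class b x" for x'
  proof -
    obtain u where "x' = x + b [u]"
      using coh_class_memD(3) [OF x'] by blast
    then have "bar gr x' = bar gr x + b [- bar gr u]"
      by (simp add: bar_add b1_minus b1_bar)
    then show ?thesis
      using coh_class_add_exact [OF bar_cocycle [OF assms]] by simp
  qed
  moreover have "coh_class b x \<noteq> {}"
    using coh_class_self assms by blast
  ultimately show ?thesis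
    unfolding coh_bar_def by (intro SUP_eq_const)
qed

lemma coh_uminus_coh_class:
  assumes "x \<in> cocycles b"
  shows "coh_uminus b (coh_class b x) = coh_class b (- x)"
proof -
  have "coh_class b (- x') = coh_class b (- x)" if x': "x' \<in> coh_class b x" for x'
  proof -
    obtain u where "x' = x + b [u]"
      using coh_class_memD(3) [OF x'] by blast
    then have "- x' = - x + b [- u]"
      by (simp add: b1_minus)
    moreover have "- x \<in> cocycles b"
      using assms by (simp add: cocycles_def b1_minus)
    ultimately show ?thesis
      using coh_class_add_exact by metis
  qed
  moreover have "coh_class b x \<noteq> {}"
    using coh_class_self assms by blast
  ultimately show ?thesis
    unfolding coh_uminus_def by (intro SUP_eq_const)
qed

text \<open>On a class that is homogeneous of degree \<open>d\<close>, the induced bar is the sign \<open>(-1)\<^sup>d\<close>.\<close>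

lemma coh_bar_homogeneous:
  "\<lbrakk>x \<in> cocycles b; x \<in> gr d\<rbrakk> \<Longrightarrow>
    coh_bar gr b (coh_class b x) =
      (if even d then coh_class b x else coh_uminus b (coh_class b x))"
  by (simp add: coh_bar_coh_class coh_uminus_coh_class bar_homogeneous parity_sign_def)

lemma b_eq_0: "0 \<in> set xs \<Longrightarrow> b xs = 0"
  by (metis b_zero split_list)

lemma b_odot_power_eq_0:
  assumes a: "a \<in> strictly_upper m" and "n > m"
  shows "b_odot_power b m n a i j = 0"
proof -
  have nonzero: "i < j \<and> j \<le> m" if "a i j \<noteq> 0" for i j
    using a that unfolding strictly_upper_def by blast
  have chain: "i + n \<le> j \<and> j \<le> m"
    if "0 \<notin> set (map2 a (i # ks) (ks @ [j]))" "length ks = n - 1" "n \<ge> 1" for ks n i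
    using that
  proof (induction ks arbitrary: i n)
    case Nil
    then show ?case
      using nonzero [of i j] by auto
  next
    case (Cons k ks)
    have "k + (n - 1) \<le> j \<and> j \<le> m"
      using Cons.prems by (intro Cons.IH) auto
    moreover have "i < k"
      using Cons.prems nonzero [of i k] by auto
    ultimately show ?case
      using Cons.prems(3) by linarith
  qed
  have "b (map2 a (i # ks) (ks @ [j])) = 0" if "length ks = n - 1" for ks
    using chain [of i ks n] that \<open>n > m\<close> by (intro b_eq_0) (cases "n \<ge> 1"; force)
  then show ?thesis
    by (simp add: b_odot_power_def)
qed

end

end

theory Submission
  imports Defs
begin

text \<open>
  Let \<open>c\<close> be a cocycle representing \<open>\<gamma>\<close>, and let \<open>a\<close> be a defining system for
  \<open>\<alpha>\<^sub>1, \<dots>, \<alpha>\<^sub>m\<close>.  Enlarge \<open>a\<close> by one row and column to a strictly upper triangular matrix \<open>e\<close>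
  whose only new nonzero entry is \<open>c\<close>, at position \<open>(m, m + 1)\<close>.  The new defining system \<open>a'\<close>
  has the entries \<open>bar (a i j)\<close> in the columns \<open>j < m\<close> and, in its last column, the entries of
  \<open>\<partial>\<^sub>e e\<close> in column \<open>m + 1\<close>, that is, the sums of all \<open>b (a, \<dots>, a, c)\<close> along the paths of
  indices from \<open>i\<close> to \<open>m\<close>.  On the superdiagonal this gives representatives of the bars of the
  \<open>\<alpha>\<^sub>i\<close> and of the product of \<open>\<alpha>\<^sub>m\<close> with \<open>\<gamma>\<close>.

  Summing the A-infinity relation over the paths of indices from \<open>i\<close> to \<open>j\<close>, and collecting the
  paths that run through the inner operation, gives a Bianchi identity (lemma \<open>Bianchi\<close>): for
  every matrix \<open>a\<close>, the \<open>(i, j)\<close> entries of all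
  \<open>b (bar a \<odot> \<dots> \<odot> bar a \<odot> \<partial>\<^sub>a a \<odot> a \<odot> \<dots> \<odot> a)\<close> add up to zero.  It is used twice.
  For a defining system only the corner of \<open>\<partial>\<^sub>a a\<close> survives, and the identity says that
  this corner is a cocycle (lemma \<open>cocycle_curvature\<close>).  For the enlarged matrix \<open>e\<close> and the
  position \<open>(i, m + 1)\<close>, the inner curvatures in column \<open>m + 1\<close> are the last column of \<open>a'\<close>, and
  they contribute exactly \<open>\<partial>a'\<close> at \<open>(i, m)\<close> (the one in row \<open>m\<close> vanishes because \<open>c\<close> is a
  cocycle); the only other surviving inner curvature is
  the corner \<open>\<mu>(a)\<close> of \<open>\<partial>\<^sub>a a\<close>, present for \<open>i = 0\<close> and followed by \<open>c\<close>.  Hence \<open>\<partial>a'\<close>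
  vanishes in the last column off the corner, and \<open>\<mu>(a') = - b\<^sub>2(\<mu>(a), c)\<close> (lemma
  \<open>curvature_multiply_by_last\<close>).  In the columns \<open>j < m\<close>, \<open>\<partial>a'\<close> is minus the bar of \<open>\<partial>\<^sub>a a\<close>,
  because every \<open>b\<^sub>n\<close> has degree one, so it vanishes too.

  The bars are what makes these sums free of signs: the Koszul sign in the A-infinity relation is
  absorbed by barring the entries in front of the inner operation, which also makes sense for
  entries that are not homogeneous.
\<close>

section \<open>Additive extension from homogeneous elements\<close>

context graded_vector_space
begin

text \<open>
  The entries of a list are replaced by homogeneous ones from left to right, each by additivity
  in that entry.
\<close>

lemma multiadditive_eqI:
  fixes F G :: "'a list \<Rightarrow> 'a"
  assumes F: "\<And>us x y vs. F (us @ (x + y) # vs) = F (us @ x # vs) + F (us @ y # vs)"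
    and G: "\<And>us x y vs. G (us @ (x + y) # vs) = G (us @ x # vs) + G (us @ y # vs)"
    and hom: "\<And>xs ds. \<lbrakk>xs \<noteq> []; list_all2 (\<lambda>x d. x \<in> gr d) xs ds\<rbrakk> \<Longrightarrow> F xs = G xs"
    and "xs \<noteq> []"
  shows "F xs = G xs"
proof -
  have "F (us @ vs) = G (us @ vs)"
    if "list_all2 (\<lambda>x d. x \<in> gr d) us ds" "us @ vs \<noteq> []" for us vs ds
    using that
  proof (induction vs arbitrary: us ds)
    case Nil
    then show ?case by (simp add: hom)
  next
    case (Cons v vs)
    show ?case
    proof (rule additive_eqI [where x = v and f = "\<lambda>v. F (us @ v # vs)" and g = "\<lambda>v. G (us @ v # vs)"])
      fix d x assume "x \<in> gr d"
      then have "list_all2 (\<lambda>x d. x \<in> gr d) (us @ [x]) (ds @ [d])"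
        using Cons.prems(1) by (intro list_all2_appendI) simp_all
      from Cons.IH [OF this] show "F (us @ x # vs) = G (us @ x # vs)"
        by simp
    qed (simp_all add: F G)
  qed
  from this [of "[]" "[]" xs] show ?thesis
    using \<open>xs \<noteq> []\<close> by simp
qed

end

context a_infinity_algebra
begin

lemma b_sum:
  "finite S \<Longrightarrow> b (us @ (\<Sum>x\<in>S. f x) # vs) = (\<Sum>x\<in>S. b (us @ f x # vs))"
  by (induction rule: finite_induct) (simp_all add: b_zero b_add)

text \<open>Barring a homogeneous argument list produces its Koszul sign.\<close>

lemma b_bar_prefix:
  assumes "list_all2 (\<lambda>x d. x \<in> gr d) xs ds"
  shows "b (us @ map (bar gr) xs @ vs) = parity_sign (sum_list ds) (b (us @ xs @ vs))"
  using assms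
proof (induction arbitrary: us rule: list_all2_induct)
  case Nil
  then show ?case by (simp add: parity_sign_def)
next
  case (Cons x xs d ds)
  have "b (us @ map (bar gr) (x # xs) @ vs) =
      parity_sign (sum_list ds) (b ((us @ [bar gr x]) @ xs @ vs))"
    using Cons.IH [of "us @ [bar gr x]"] by simp
  also have "b ((us @ [bar gr x]) @ xs @ vs) = parity_sign d (b (us @ x # xs @ vs))"
    using Cons.hyps by (simp add: bar_homogeneous parity_sign_def b_minus)
  also have "parity_sign (sum_list ds) \<dots> = parity_sign (sum_list (d # ds)) (b (us @ x # xs @ vs))"
    by (simp add: parity_sign_def)
  finally show ?case by simp
qed

text \<open>The sign comes from the degree \<open>1\<close> of the operations.\<close>

lemma b_map_bar:
  assumes "xs \<noteq> []"
  shows "b (map (bar gr) xs) = - bar gr (b xs)"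
proof (rule multiadditive_eqI [where F = "\<lambda>xs. b (map (bar gr) xs)" and G = "\<lambda>xs. - bar gr (b xs)"])
  fix xs :: "'a list" and ds :: "'g list"
  assume xs: "xs \<noteq> []" "list_all2 (\<lambda>x d. x \<in> gr d) xs ds"
  show "b (map (bar gr) xs) = - bar gr (b xs)"
    using b_bar_prefix [OF xs(2), of "[]" "[]"] bar_homogeneous [OF degree_one [OF xs]]
    by (simp add: parity_sign_def)
qed (simp_all add: assms b_add bar_add)

text \<open>
  The summed argument may stand before, inside or after the block of the inner operation; the
  three cases use additivity of the bar, of the inner and of the outer operation.
\<close>

lemma b_nested_add:
  fixes r s :: nat
  defines "T \<equiv> \<lambda>xs. b (map (bar gr) (take r xs) @ b (take s (drop r xs)) # drop (r + s) xs)"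
  shows "T (us @ (x + y) # vs) = T (us @ x # vs) + T (us @ y # vs)"
proof -
  consider "length us < r" | "r \<le> length us" "length us < r + s" | "r + s \<le> length us"
    by linarith
  then show ?thesis
  proof cases
    case 1
    then obtain k where k: "r = Suc (length us + k)"
      using less_imp_Suc_add by blast
    show ?thesis
      unfolding T_def k using b_add
      by (simp add: bar_add)
  next
    case 2
    then obtain k where k: "r + s - length us = Suc k"
      by (metis Suc_diff_Suc)
    have s: "s - (length us - r) = Suc k"
      using 2 k by linarith
    show ?thesis
      unfolding T_def using 2 by (simp add: k s b_add)
  next
    case 3
    have "s \<le> length us - r" using 3 by linarith
    then show ?thesis
      unfolding T_def using 3
      using b_add [of "map (bar gr) (take r us) @ b (take s (drop r us)) # drop (r + s) us"]
      by simp
  qed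
qed

text \<open>
  With bars in place of the Koszul signs, the relations are additive in every argument, so that
  they extend from homogeneous arguments to all arguments.
\<close>

lemma a_infinity_relation_bar:
  assumes "xs \<noteq> []"
  shows "(\<Sum>r<length xs. \<Sum>s=1..length xs - r.
    b (map (bar gr) (take r xs) @ b (take s (drop r xs)) # drop (r + s) xs)) = 0"
    (is "?F xs = 0")
proof (rule multiadditive_eqI [where F = ?F and G = "\<lambda>_. 0"])
  fix xs :: "'a list" and ds :: "'g list"
  assume xs: "xs \<noteq> []" "list_all2 (\<lambda>x d. x \<in> gr d) xs ds"
  show "?F xs = 0"
    using a_infinity_relation [OF xs] b_bar_prefix [OF list_all2_takeI [OF xs(2)], of "[]"]
    by simp
next
  fix us x y vs
  show "?F (us @ (x + y) # vs) = ?F (us @ x # vs) + ?F (us @ y # vs)"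
    by (simp only: b_nested_add sum.distrib length_append length_Cons)
qed (simp_all add: assms)

end

section \<open>Increasing paths\<close>

text \<open>
  A product of entries of a strictly upper triangular matrix that contributes to position
  \<open>(i, j)\<close> belongs to a strictly increasing path of indices from \<open>i\<close> to \<open>j\<close>.  A path includes its
  end points, so that for \<open>i = j\<close> there is the one trivial path \<open>[i]\<close>, which carries no entries.
\<close>

definition paths :: "nat \<Rightarrow> nat \<Rightarrow> nat list set" where
  "paths i j = {vs. vs \<noteq> [] \<and> sorted_wrt (<) vs \<and> hd vs = i \<and> last vs = j}"

definition entries :: "(nat \<Rightarrow> nat \<Rightarrow> 'a) \<Rightarrow> nat list \<Rightarrow> 'a list" where
  "entries a vs = map2 a vs (tl vs)"

lemma entries_simps [simp]:
  "entries a [] = []"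
  "entries a [i] = []"
  "entries a (i # j # vs) = a i j # entries a (j # vs)"
  by (simp_all add: entries_def)

lemma length_entries [simp]: "length (entries a vs) = length vs - 1"
  by (simp add: entries_def)

lemma nth_entries: "Suc n < length vs \<Longrightarrow> entries a vs ! n = a (vs ! n) (vs ! Suc n)"
  by (simp add: entries_def nth_tl)

lemma entries_drop: "entries a (drop n vs) = drop n (entries a vs)"
  by (simp add: entries_def drop_map drop_zip tl_drop)

lemma entries_take: "entries a (take (Suc n) vs) = take n (entries a vs)"
proof (rule nth_equalityI)
  fix i assume "i < length (entries a (take (Suc n) vs))"
  then show "entries a (take (Suc n) vs) ! i = take n (entries a vs) ! i"
    by (subst nth_entries) (auto simp: nth_entries)
qed auto

lemma entries_snoc: "vs \<noteq> [] \<Longrightarrow> entries a (vs @ [j]) = entries a vs @ [a (last vs) j]"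
  by (induction vs rule: induct_list012) simp_all

lemma entries_map: "entries (\<lambda>i j. f (a i j)) vs = map f (entries a vs)"
  by (auto simp: entries_def)

lemma paths_ConsE:
  assumes "vs \<in> paths i j"
  obtains ws where "vs = i # ws"
  using assms by (cases vs) (auto simp: paths_def)

lemma paths_snocE:
  assumes "vs \<in> paths i j"
  obtains ws where "vs = ws @ [j]"
  using assms by (cases vs rule: rev_cases) (auto simp: paths_def)

lemma paths_bounds:
  assumes "vs \<in> paths i j" "v \<in> set vs"
  shows "i \<le> v" "v \<le> j"
proof -
  obtain us ws where "vs = i # us" "vs = ws @ [j]"
    using assms(1) by (metis paths_ConsE paths_snocE)
  moreover have "sorted_wrt (<) vs"
    using assms(1) by (simp add: paths_def)
  ultimately have "sorted_wrt (<) (i # us)" "v \<in> set (i # us)"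
    "sorted_wrt (<) (ws @ [j])" "v \<in> set (ws @ [j])"
    using assms(2) by simp_all
  then show "i \<le> v" "v \<le> j"
    by (auto simp: sorted_wrt_append intro: less_imp_le)
qed

lemma finite_paths [simp]: "finite (paths i j)"
proof (rule finite_subset)
  show "paths i j \<subseteq> {vs. set vs \<subseteq> {i..j} \<and> distinct vs}"
    using paths_bounds by (auto simp: paths_def strict_sorted_iff)
qed (simp add: finite_subset_distinct)

lemma paths_refl [simp]: "paths i i = {[i]}"
proof -
  have "vs = [i]" if "vs \<in> paths i i" for vs
  proof (cases vs)
    case (Cons v ws)
    then have "v = i" "\<forall>w\<in>set ws. i < w" "\<forall>w\<in>set ws. w \<le> i"
      using that paths_bounds [OF that] by (auto simp: paths_def)
    then show ?thesis
      using Cons by (cases ws) auto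
  qed (use that in \<open>simp add: paths_def\<close>)
  then show ?thesis
    by (auto simp: paths_def)
qed

lemma entries_cong:
  assumes "vs \<in> paths i j" "\<And>k l. \<lbrakk>i \<le> k; k < l; l \<le> j\<rbrakk> \<Longrightarrow> a k l = a' k l"
  shows "entries a vs = entries a' vs"
proof (rule nth_equalityI)
  fix n assume "n < length (entries a vs)"
  then have n: "Suc n < length vs"
    by simp
  then have "vs ! n < vs ! Suc n"
    using assms(1) by (simp add: paths_def sorted_wrt_nth_less)
  then show "entries a vs ! n = entries a' vs ! n"
    using n paths_bounds [OF assms(1)] by (simp add: nth_entries assms(2))
qed simp

lemma paths_snoc:
  assumes "vs \<in> paths i k" "k < j"
  shows "vs @ [j] \<in> paths i j"
  using assms paths_bounds [OF assms(1)] by (fastforce simp: paths_def sorted_wrt_append)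

lemma paths_unsnocE:
  assumes "vs \<in> paths i j" "i < j"
  obtains ws k where "vs = ws @ [j]" "ws \<in> paths i k" "i \<le> k" "k < j"
proof -
  obtain ws where vs: "vs = ws @ [j]"
    using assms(1) by (rule paths_snocE)
  have ne: "ws \<noteq> []"
    using assms vs by (auto simp: paths_def)
  then have ws: "ws \<in> paths i (last ws)" "last ws < j"
    using assms(1) vs by (auto simp: paths_def sorted_wrt_append)
  then show thesis
    using that [OF vs ws(1) _ ws(2)] paths_bounds(1) [OF ws(1), of "last ws"] ne by simp
qed

lemma entries_nonempty:
  assumes "vs \<in> paths i j" "i < j"
  shows "entries a vs \<noteq> []"
proof -
  obtain ws k where "vs = ws @ [j]" "ws \<in> paths i k"
    using assms by (rule paths_unsnocE)
  then show ?thesis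
    by (simp add: entries_snoc paths_def)
qed

text \<open>Classify the paths by their last step.\<close>

lemma sum_paths_snoc:
  assumes "i < j"
  shows "(\<Sum>vs\<in>paths i j. f vs) = (\<Sum>k\<in>{i..<j}. \<Sum>vs\<in>paths i k. f (vs @ [j]))"
proof -
  have "(\<Sum>k\<in>{i..<j}. \<Sum>vs\<in>paths i k. f (vs @ [j])) =
      (\<Sum>(k, vs)\<in>(SIGMA k:{i..<j}. paths i k). f (vs @ [j]))"
    by (simp add: sum.Sigma)
  also have "\<dots> = (\<Sum>vs\<in>paths i j. f vs)"
  proof (rule sum.reindex_bij_witness [where i = "\<lambda>vs. (last (butlast vs), butlast vs)"
      and j = "\<lambda>(k, vs). vs @ [j]"])
    fix vs assume "vs \<in> paths i j"
    then obtain ws k where ws: "vs = ws @ [j]" "ws \<in> paths i k" "i \<le> k" "k < j"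
      using assms by (rule paths_unsnocE)
    moreover have "last ws = k"
      using ws(2) by (simp add: paths_def)
    ultimately show "(case (last (butlast vs), butlast vs) of (k, vs) \<Rightarrow> vs @ [j]) = vs"
      "(last (butlast vs), butlast vs) \<in> (SIGMA k:{i..<j}. paths i k)"
      by simp_all
  next
    fix z assume "z \<in> (SIGMA k:{i..<j}. paths i k)"
    then obtain k vs where z: "z = (k, vs)" "k < j" "vs \<in> paths i k"
      by auto
    moreover have "last vs = k"
      using z(3) by (simp add: paths_def)
    ultimately show "(case z of (k, vs) \<Rightarrow> vs @ [j]) \<in> paths i j"
      "(last (butlast (case z of (k, vs) \<Rightarrow> vs @ [j])), butlast (case z of (k, vs) \<Rightarrow> vs @ [j])) = z"
      by (simp_all add: paths_snoc)
  qed auto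
  finally show ?thesis by simp
qed

lemma paths_Suc [simp]: "paths i (Suc i) = {[i, Suc i]}"
proof -
  have "vs = [i, Suc i]" if vs: "vs \<in> paths i (Suc i)" for vs
  proof -
    obtain ws k where "vs = ws @ [Suc i]" "ws \<in> paths i k" "i \<le> k" "k < Suc i"
      using vs lessI by (rule paths_unsnocE)
    moreover from this have "k = i" by simp
    ultimately show ?thesis by simp
  qed
  then show ?thesis by (auto simp: paths_def)
qed

lemma paths_append:
  assumes "p \<in> paths i k" "q \<in> paths k l"
  shows "p @ tl q \<in> paths i l"
proof -
  obtain p' where p: "p = p' @ [k]"
    using assms(1) by (rule paths_snocE)
  obtain q' where q: "q = k # q'"
    using assms(2) by (rule paths_ConsE)
  have "x < y" if "x \<in> set p'" "y \<in> set q'" for x y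
    using assms that unfolding p q paths_def
    by (auto simp: sorted_wrt_append intro: less_trans [of x k y])
  then show ?thesis
    using assms unfolding p q
    by (cases p') (auto simp: paths_def sorted_wrt_append)
qed

lemma paths_take:
  assumes "vs \<in> paths i j" "n < length vs"
  shows "take (Suc n) vs \<in> paths i (vs ! n)"
proof -
  have "last (take (Suc n) vs) = vs ! n"
    using assms(2) by (simp add: take_Suc_conv_app_nth)
  then show ?thesis
    using assms by (auto simp: paths_def)
qed

lemma paths_drop:
  assumes "vs \<in> paths i j" "n < length vs"
  shows "drop n vs \<in> paths (vs ! n) j"
  using assms by (auto simp: paths_def hd_drop_conv_nth)

text \<open>
  Choosing a nontrivial segment of a path, by its starting position \<open>r\<close> and its number \<open>s\<close> of
  steps, amounts to cutting the path into three, at the end points \<open>k < l\<close> of the segment.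
\<close>

lemma sum_subpaths:
  fixes f :: "nat list \<Rightarrow> nat list \<Rightarrow> nat list \<Rightarrow> 'b::comm_monoid_add"
  shows "(\<Sum>vs\<in>paths i j. \<Sum>r<length vs - 1. \<Sum>s=1..length vs - 1 - r.
        f (take (Suc r) vs) (take (Suc s) (drop r vs)) (drop (r + s) vs)) =
    (\<Sum>k\<in>{i..j}. \<Sum>l\<in>{k<..j}. \<Sum>p\<in>paths i k. \<Sum>t\<in>paths l j. \<Sum>q\<in>paths k l. f p q t)"
    (is "?L = ?R")
proof -
  let ?A = "SIGMA vs:paths i j. SIGMA r:{..<length vs - 1}. {1..length vs - 1 - r}"
  let ?B = "SIGMA k:{i..j}. SIGMA l:{k<..j}. paths i k \<times> paths l j \<times> paths k l"
  have "?L = (\<Sum>(vs, r, s)\<in>?A. f (take (Suc r) vs) (take (Suc s) (drop r vs)) (drop (r + s) vs))"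
    by (simp add: sum.Sigma)
  also have "\<dots> = (\<Sum>(k, l, p, t, q)\<in>?B. f p q t)"
  proof (rule sum.reindex_bij_witness [where
        j = "\<lambda>(vs, r, s). (vs ! r, vs ! (r + s), take (Suc r) vs, drop (r + s) vs,
          take (Suc s) (drop r vs))"
        and i = "\<lambda>(k, l, p, t, q). (p @ tl (q @ tl t), length p - 1, length q - 1)"])
    fix z assume "z \<in> ?A"
    then obtain vs r s where z: "z = (vs, r, s)" and vs: "vs \<in> paths i j"
      and rs: "1 \<le> s" "r + s < length vs"
      by auto
    have q: "take (Suc s) (drop r vs) \<in> paths (vs ! r) (vs ! (r + s))"
      using paths_take [OF paths_drop [OF vs], of r s] rs by simp
    have "vs ! r < vs ! (r + s)"
      using vs rs by (intro sorted_wrt_nth_less [of "(<)" vs]) (auto simp: paths_def)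
    then show "(case z of (vs, r, s) \<Rightarrow> (vs ! r, vs ! (r + s), take (Suc r) vs, drop (r + s) vs,
          take (Suc s) (drop r vs))) \<in> ?B"
      using rs q paths_take [OF vs, of r] paths_drop [OF vs, of "r + s"]
        paths_bounds [OF vs] by (simp add: z)
    have tl_drop': "tl (drop n vs) = drop (Suc n) vs" for n
      by (simp add: drop_Suc tl_drop)
    have "tl (take (Suc s) (drop r vs) @ tl (drop (r + s) vs)) =
        take s (drop (Suc r) vs) @ drop (Suc r + s) vs"
      using rs by (subst tl_append2) (simp_all add: tl_take tl_drop')
    also have "\<dots> = drop (Suc r) vs"
      by (metis add.commute append_take_drop_id drop_drop)
    finally have "take (Suc r) vs @ tl (take (Suc s) (drop r vs) @ tl (drop (r + s) vs)) = vs"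
      by simp
    then show "(case case z of (vs, r, s) \<Rightarrow> (vs ! r, vs ! (r + s), take (Suc r) vs, drop (r + s) vs,
          take (Suc s) (drop r vs)) of
        (k, l, p, t, q) \<Rightarrow> (p @ tl (q @ tl t), length p - 1, length q - 1)) = z"
      using rs by (simp add: z)
  next
    fix z assume "z \<in> ?B"
    then obtain k l p q t where z: "z = (k, l, p, t, q)" and kl: "i \<le> k" "k < l" "l \<le> j"
      and p: "p \<in> paths i k" and q: "q \<in> paths k l" and t: "t \<in> paths l j"
      by auto
    obtain p' where p': "p = p' @ [k]"
      using p by (rule paths_snocE)
    obtain t' where t': "t = l # t'"
      using t by (rule paths_ConsE)
    obtain q'' where q'': "q = q'' @ [l]"
      using q by (rule paths_snocE)
    obtain q' where q': "q = k # q' @ [l]"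
      using q kl unfolding q'' by (cases q'') (auto simp: paths_def)
    show "(case case z of (k, l, p, t, q) \<Rightarrow> (p @ tl (q @ tl t), length p - 1, length q - 1) of
        (vs, r, s) \<Rightarrow> (vs ! r, vs ! (r + s), take (Suc r) vs, drop (r + s) vs,
          take (Suc s) (drop r vs))) = z"
      by (simp add: z p' q' t' nth_append)
    have "p @ tl (q @ tl t) \<in> paths i j"
      by (intro paths_append [OF p] paths_append [OF q] t)
    then show "(case z of (k, l, p, t, q) \<Rightarrow> (p @ tl (q @ tl t), length p - 1, length q - 1)) \<in> ?A"
      by (simp add: z p' q' t')
  qed auto
  also have "\<dots> = ?R"
    by (simp add: sum.Sigma)
  finally show ?thesis .
qed

section \<open>The Bianchi identity\<close>

text \<open>
  The entry of \<open>\<partial>\<^sub>a a\<close> as a sum over paths only; unlike \<^const>\<open>boundary\<close> it does not refer to the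
  size of the matrix, so that matrices of different sizes can be compared.  It is meaningful for
  \<open>i < j\<close> only: on the diagonal it is the irrelevant value \<open>b []\<close>.
\<close>

definition curvature ::
    "('a::ab_group_add list \<Rightarrow> 'a) \<Rightarrow> (nat \<Rightarrow> nat \<Rightarrow> 'a) \<Rightarrow> nat \<Rightarrow> nat \<Rightarrow> 'a" where
  "curvature b a i j = (\<Sum>vs\<in>paths i j. b (entries a vs))"

lemma curvature_Suc: "curvature b a i (Suc i) = b [a i (Suc i)]"
  by (simp add: curvature_def)

lemma curvature_cong:
  "(\<And>k l. \<lbrakk>i \<le> k; k < l; l \<le> j\<rbrakk> \<Longrightarrow> a k l = a' k l) \<Longrightarrow> curvature b a i j = curvature b a' i j"
  unfolding curvature_def by (intro sum.cong refl arg_cong [where f = b] entries_cong) auto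

lemma strictly_upper_entry_less:
  "\<lbrakk>a \<in> strictly_upper m; a i j \<noteq> 0\<rbrakk> \<Longrightarrow> i < j \<and> j \<le> m"
  unfolding strictly_upper_def by blast

context a_infinity_algebra
begin

lemma b_entries_eq_0:
  assumes a: "a \<in> strictly_upper m" and "\<not> sorted_wrt (<) vs"
  shows "b (entries a vs) = 0"
proof (rule b_eq_0)
  obtain n where n: "Suc n < length vs" "\<not> vs ! n < vs ! Suc n"
    using assms(2) by (auto simp: sorted_wrt_iff_nth_Suc_transp)
  then have "entries a vs ! n = 0"
    using strictly_upper_entry_less [OF a] by (auto simp: nth_entries)
  then show "0 \<in> set (entries a vs)"
    using n(1) nth_mem [of n "entries a vs"] by simp
qed

text \<open>The length of the list of intermediate indices accounts for the sum over the arity.\<close>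

lemma boundary_eq_sum_lists:
  "boundary b m a i j =
    (\<Sum>ks | set ks \<subseteq> {0..m} \<and> length ks < m. b (entries a (i # ks @ [j])))"
proof -
  have fin: "finite {ks. set ks \<subseteq> {0..m} \<and> length ks = n}" for n
    by (simp add: finite_lists_length_eq)
  have "map2 a (i # ks) (ks @ [j]) = entries a (i # ks @ [j])" for ks
    unfolding entries_def using zip_append1 [of "i # ks" "[j]" "ks @ [j]"] by simp
  then have "boundary b m a i j = (\<Sum>(n, ks)\<in>(SIGMA n:{1..m}. {ks. set ks \<subseteq> {0..m} \<and> length ks = n - 1}).
      b (entries a (i # ks @ [j])))"
    by (simp add: boundary_def b_odot_power_def sum.Sigma fin)
  also have "\<dots> = (\<Sum>ks | set ks \<subseteq> {0..m} \<and> length ks < m. b (entries a (i # ks @ [j])))"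
    by (rule sum.reindex_bij_witness [where i = "\<lambda>ks. (Suc (length ks), ks)" and j = snd]) auto
  finally show ?thesis .
qed

lemma boundary_eq_0:
  assumes "a \<in> strictly_upper m" "j \<le> i"
  shows "boundary b m a i j = 0"
  unfolding boundary_eq_sum_lists
proof (intro sum.neutral ballI)
  fix ks
  have "\<not> sorted_wrt (<) (i # ks @ [j])"
    using assms(2) by simp
  then show "b (entries a (i # ks @ [j])) = 0"
    by (rule b_entries_eq_0 [OF assms(1)])
qed

text \<open>
  Index lists that are not increasing contribute zero, and increasing ones are short enough to be
  covered by the bound on the arity.
\<close>

lemma boundary_eq_curvature:
  assumes a: "a \<in> strictly_upper m" and "i < j" "j \<le> m"
  shows "boundary b m a i j = curvature b a i j"
proof -
  let ?K = "{ks. i # ks @ [j] \<in> paths i j}"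
  have K: "set ks \<subseteq> {0..m}" "length ks < m" if "ks \<in> ?K" for ks
  proof -
    have path: "i # ks @ [j] \<in> paths i j"
      using that by simp
    have *: "set (i # ks @ [j]) \<subseteq> {0..m}"
    proof
      fix v assume "v \<in> set (i # ks @ [j])"
      then show "v \<in> {0..m}"
        using paths_bounds(2) [OF path] \<open>j \<le> m\<close> by fastforce
    qed
    have d: "distinct (i # ks @ [j])"
      using path unfolding paths_def strict_sorted_iff by blast
    from * show "set ks \<subseteq> {0..m}" by simp
    have "length (i # ks @ [j]) \<le> card {0..m}"
      using card_mono [OF _ *] distinct_card [OF d] by simp
    then show "length ks < m" by simp
  qed
  have "boundary b m a i j = (\<Sum>ks\<in>?K. b (entries a (i # ks @ [j])))"
    unfolding boundary_eq_sum_lists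
  proof (rule sum.mono_neutral_right)
    show "finite {ks. set ks \<subseteq> {0..m} \<and> length ks < m}"
      by (rule finite_subset [OF _ finite_lists_length_le [of "{0..m}" m]]) auto
    show "\<forall>ks\<in>{ks. set ks \<subseteq> {0..m} \<and> length ks < m} - ?K. b (entries a (i # ks @ [j])) = 0"
    proof
      fix ks assume "ks \<in> {ks. set ks \<subseteq> {0..m} \<and> length ks < m} - ?K"
      then have "\<not> sorted_wrt (<) (i # ks @ [j])"
        by (simp add: paths_def)
      then show "b (entries a (i # ks @ [j])) = 0"
        by (rule b_entries_eq_0 [OF a])
    qed
  qed (use K in auto)
  also have "\<dots> = curvature b a i j"
    unfolding curvature_def
  proof (rule sum.reindex_bij_witness [where i = "\<lambda>vs. butlast (tl vs)" and j = "\<lambda>ks. i # ks @ [j]"])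
    fix vs assume vs: "vs \<in> paths i j"
    then obtain ws where "vs = i # ws"
      by (cases vs) (auto simp: paths_def)
    with vs \<open>i < j\<close> show "i # butlast (tl vs) @ [j] = vs"
      by (auto simp: paths_def split: if_splits)
    with vs show "butlast (tl vs) \<in> ?K"
      by simp
  qed auto
  finally show ?thesis .
qed

text \<open>
  This is the sum of the A-infinity relations for all paths from \<open>i\<close> to \<open>j\<close>.  For fixed outer
  parts \<open>p\<close> and \<open>t\<close>, the inner paths from \<open>k\<close> to \<open>l\<close> add up to the curvature.
\<close>

lemma Bianchi:
  assumes "i < j"
  shows "(\<Sum>k\<in>{i..j}. \<Sum>l\<in>{k<..j}. \<Sum>p\<in>paths i k. \<Sum>t\<in>paths l j.
    b (map (bar gr) (entries a p) @ curvature b a k l # entries a t)) = 0"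
proof -
  have "(\<Sum>k\<in>{i..j}. \<Sum>l\<in>{k<..j}. \<Sum>p\<in>paths i k. \<Sum>t\<in>paths l j.
      b (map (bar gr) (entries a p) @ curvature b a k l # entries a t)) =
    (\<Sum>k\<in>{i..j}. \<Sum>l\<in>{k<..j}. \<Sum>p\<in>paths i k. \<Sum>t\<in>paths l j. \<Sum>q\<in>paths k l.
      b (map (bar gr) (entries a p) @ b (entries a q) # entries a t))"
    by (simp add: curvature_def b_sum)
  also have "\<dots> = (\<Sum>vs\<in>paths i j. \<Sum>r<length vs - 1. \<Sum>s=1..length vs - 1 - r.
      b (map (bar gr) (take r (entries a vs)) @ b (take s (drop r (entries a vs))) #
        drop (r + s) (entries a vs)))"
    unfolding sum_subpaths [symmetric] entries_take entries_drop ..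
  also have "\<dots> = 0"
  proof (rule sum.neutral, rule ballI)
    fix vs assume "vs \<in> paths i j"
    from a_infinity_relation_bar [OF entries_nonempty [OF this \<open>i < j\<close>]]
    show "(\<Sum>r<length vs - 1. \<Sum>s=1..length vs - 1 - r.
      b (map (bar gr) (take r (entries a vs)) @ b (take s (drop r (entries a vs))) #
        drop (r + s) (entries a vs))) = 0"
      by (simp only: length_entries)
  qed
  finally show ?thesis .
qed

section \<open>Multiplying a defining system by a cocycle\<close>

text \<open>If only the corner of the curvature is left, then the Bianchi identity has a single term.\<close>

lemma cocycle_curvature:
  assumes "i < j" and flat: "\<And>k l. \<lbrakk>i \<le> k; k < l; l \<le> j; (k, l) \<noteq> (i, j)\<rbrakk> \<Longrightarrow> curvature b a k l = 0"
  shows "b [curvature b a i j] = 0"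
proof -
  let ?G = "\<lambda>k l. \<Sum>p\<in>paths i k. \<Sum>t\<in>paths l j.
    b (map (bar gr) (entries a p) @ curvature b a k l # entries a t)"
  have G: "?G k l = (if k = i \<and> l = j then b [curvature b a i j] else 0)"
    if "k \<in> {i..j}" "l \<in> {k<..j}" for k l
    using that flat [of k l] by (auto simp: b_zero)
  have "0 = (\<Sum>k\<in>{i..j}. \<Sum>l\<in>{k<..j}. ?G k l)"
    using Bianchi [OF \<open>i < j\<close>, of a] by simp
  also have "\<dots> = (\<Sum>k\<in>{i..j}. \<Sum>l\<in>{k<..j}. if k = i \<and> l = j then b [curvature b a i j] else 0)"
    by (intro sum.cong refl G)
  also have "\<dots> = (\<Sum>k\<in>{i..j}. if k = i then b [curvature b a i j] else 0)"
    using \<open>i < j\<close> by (intro sum.cong) auto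
  also have "\<dots> = b [curvature b a i j]"
    using \<open>i < j\<close> by simp
  finally show ?thesis by simp
qed

lemma curvature_bar:
  assumes "i < j"
  shows "curvature b (\<lambda>k l. bar gr (a k l)) i j = - bar gr (curvature b a i j)"
proof -
  have bar_sum': "bar gr (\<Sum>x\<in>S. f x) = (\<Sum>x\<in>S. bar gr (f x))" if "finite S" for f and S :: "nat list set"
    using that by induction (simp_all add: bar_add)
  have "curvature b (\<lambda>k l. bar gr (a k l)) i j = (\<Sum>vs\<in>paths i j. - bar gr (b (entries a vs)))"
    unfolding curvature_def
    by (rule sum.cong) (auto simp: entries_map intro!: b_map_bar entries_nonempty [OF _ assms])
  also have "\<dots> = - bar gr (curvature b a i j)"
    by (simp only: curvature_def bar_sum' [OF finite_paths] sum_negf)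
  finally show ?thesis .
qed

definition extend_by :: "'a \<Rightarrow> nat \<Rightarrow> (nat \<Rightarrow> nat \<Rightarrow> 'a) \<Rightarrow> nat \<Rightarrow> nat \<Rightarrow> 'a" where
  "extend_by c m a i j = (if i = m \<and> j = Suc m then c else a i j)"

text \<open>
  If \<open>a\<close> vanishes in column \<open>m + 1\<close>, then the entry at \<open>(i, m)\<close> with \<open>i < m\<close> is the sum of
  \<open>b (a, \<dots>, a, c)\<close> over all paths from \<open>i\<close> to \<open>m\<close>.
\<close>

definition multiply_by :: "'a \<Rightarrow> nat \<Rightarrow> (nat \<Rightarrow> nat \<Rightarrow> 'a) \<Rightarrow> nat \<Rightarrow> nat \<Rightarrow> 'a" where
  "multiply_by c m a i j =
     (if i < m \<and> j = m then curvature b (extend_by c m a) i (Suc m) else bar gr (a i j))"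

lemma curvature_extend_by: "j \<le> m \<Longrightarrow> curvature b (extend_by c m a) i j = curvature b a i j"
  by (rule curvature_cong) (simp add: extend_by_def)

lemma curvature_multiply_by_left:
  assumes "i < j" "j < m"
  shows "curvature b (multiply_by c m a) i j = - bar gr (curvature b a i j)"
proof -
  have "curvature b (multiply_by c m a) i j = curvature b (\<lambda>k l. bar gr (a k l)) i j"
    using assms by (intro curvature_cong) (simp add: multiply_by_def)
  then show ?thesis
    using curvature_bar [OF assms(1)] by simp
qed

text \<open>
  The Bianchi identity at \<open>(i, m + 1)\<close> for the matrix extended by \<open>c\<close>.  Inner paths ending in
  \<open>m + 1\<close> give the curvature on the left-hand side, inner paths ending in \<open>l \<le> m\<close> give the
  product on the right-hand side.
\<close>

lemma curvature_multiply_by_last: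
  assumes c: "b [c] = 0" and "i < m"
    and flat: "\<And>k l. \<lbrakk>k < l; l \<le> m; (k, l) \<noteq> (0, m)\<rbrakk> \<Longrightarrow> curvature b a k l = 0"
  shows "curvature b (multiply_by c m a) i m = (if i = 0 then - b [curvature b a 0 m, c] else 0)"
proof -
  let ?e = "extend_by c m a"
  let ?a' = "multiply_by c m a"
  define G where "G k l = (\<Sum>p\<in>paths i k. \<Sum>t\<in>paths l (Suc m).
    b (map (bar gr) (entries ?e p) @ curvature b ?e k l # entries ?e t))" for k l
  define M where "M = (if i = 0 then b [curvature b a 0 m, c] else 0)"
  \<comment> \<open>Where the inner path stays within the original matrix, only the corner is left.\<close>
  have inner: "(\<Sum>k=i..m. \<Sum>l\<in>{k<..m}. G k l) = M"
  proof -
    have "G k l = (if k = 0 \<and> l = m then b [curvature b a 0 m, c] else 0)"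
      if "k \<in> {i..m}" "l \<in> {k<..m}" for k l
      using that flat [of k l]
      by (auto simp: G_def curvature_extend_by b_zero extend_by_def)
    then have "(\<Sum>k=i..m. \<Sum>l\<in>{k<..m}. G k l) =
        (\<Sum>k=i..m. \<Sum>l\<in>{k<..m}. if k = 0 \<and> l = m then b [curvature b a 0 m, c] else 0)"
      by (intro sum.cong refl)
    also have "\<dots> = (\<Sum>k=i..m. if k = 0 then b [curvature b a 0 m, c] else 0)"
      using \<open>i < m\<close> by (intro sum.cong) auto
    also have "\<dots> = M"
      using \<open>i < m\<close> by (simp add: M_def)
    finally show ?thesis .
  qed
  \<comment> \<open>The inner path from \<open>m\<close> to \<open>m + 1\<close> contributes only the differential of \<open>c\<close>.\<close>
  have G_m: "G m (Suc m) = 0"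
    using c by (simp add: G_def curvature_Suc extend_by_def b_zero)
  \<comment> \<open>An inner path from \<open>k\<close> to \<open>m + 1\<close> plays the part of a last step from \<open>k\<close> to \<open>m\<close>.\<close>
  have G_last: "G k (Suc m) = (\<Sum>p\<in>paths i k. b (entries ?a' (p @ [m])))" if "k < m" for k
  proof -
    have "entries ?a' (p @ [m]) = map (bar gr) (entries ?e p) @ [curvature b ?e k (Suc m)]"
      if p: "p \<in> paths i k" for p
    proof -
      have "entries ?a' p = entries (\<lambda>k l. bar gr (?e k l)) p"
        using \<open>k < m\<close> by (intro entries_cong [OF p]) (simp add: multiply_by_def extend_by_def)
      moreover have "p \<noteq> []" "last p = k"
        using p by (simp_all add: paths_def)
      ultimately show ?thesis
        using \<open>k < m\<close> by (simp add: entries_snoc entries_map multiply_by_def)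
    qed
    then show ?thesis
      by (simp add: G_def)
  qed
  have "0 = (\<Sum>k=i..Suc m. \<Sum>l\<in>{k<..Suc m}. G k l)"
    using Bianchi [of i "Suc m" ?e] \<open>i < m\<close> by (simp add: G_def)
  also have "\<dots> = (\<Sum>k=i..m. \<Sum>l\<in>{k<..Suc m}. G k l)"
    using \<open>i < m\<close> by simp
  also have "\<dots> = (\<Sum>k=i..m. G k (Suc m) + (\<Sum>l\<in>{k<..m}. G k l))"
  proof (rule sum.cong [OF refl])
    fix k assume "k \<in> {i..m}"
    then have "{k<..Suc m} = insert (Suc m) {k<..m}" by auto
    then show "(\<Sum>l\<in>{k<..Suc m}. G k l) = G k (Suc m) + (\<Sum>l\<in>{k<..m}. G k l)" by simp
  qed
  also have "\<dots> = (\<Sum>k=i..m. G k (Suc m)) + M"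
    by (simp add: sum.distrib inner)
  also have "(\<Sum>k=i..m. G k (Suc m)) = (\<Sum>k\<in>{i..<m}. G k (Suc m))"
    using \<open>i < m\<close> G_m by (simp add: sum.last_plus)
  also have "\<dots> = curvature b ?a' i m"
    unfolding curvature_def sum_paths_snoc [OF \<open>i < m\<close>] by (intro sum.cong refl G_last) simp
  finally show ?thesis
    by (simp add: M_def eq_neg_iff_add_eq_0 split: if_splits)
qed

lemma defining_system_iff_curvature:
  assumes a: "a \<in> strictly_upper m"
  shows "defining_system b m \<alpha> a \<longleftrightarrow>
    (\<forall>i j. i < j \<longrightarrow> j \<le> m \<longrightarrow> (i, j) \<noteq> (0, m) \<longrightarrow> curvature b a i j = 0) \<and>
    (\<forall>i\<in>{1..m}. \<alpha> i = coh_class b (a (i - 1) i))"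
proof -
  have "boundary b m a i j = 0 \<longleftrightarrow> (i < j \<longrightarrow> curvature b a i j = 0)" if "j \<le> m" for i j
    using boundary_eq_0 [OF a, of j i] boundary_eq_curvature [OF a, of i j] that
    by (cases "i < j") simp_all
  then show ?thesis
    using a unfolding defining_system_def eq_off_corner_def
    by (auto dest: order.strict_implies_order [OF order.strict_trans2])
qed

lemma defining_system_multiply_by:
  assumes "m \<ge> 2" and a: "defining_system b m \<alpha> a" and c: "c \<in> cocycles b"
  defines "\<alpha>' \<equiv> \<lambda>i. if i < m then coh_bar gr b (\<alpha> i) else coh_b2 b (\<alpha> m) (coh_class b c)"
  shows "defining_system b m \<alpha>' (multiply_by c m a)"
    and "coh_class b (\<mu> b m (multiply_by c m a)) =
      coh_uminus b (coh_b2 b (coh_class b (\<mu> b m a)) (coh_class b c))"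
proof -
  let ?a' = "multiply_by c m a"
  have upper: "a \<in> strictly_upper m"
    using a by (simp add: defining_system_def)
  have flat: "curvature b a i j = 0" if "i < j" "j \<le> m" "(i, j) \<noteq> (0, m)" for i j
    using a that unfolding defining_system_iff_curvature [OF upper] by blast
  have \<alpha>: "\<alpha> i = coh_class b (a (i - 1) i)" if "i \<in> {1..m}" for i
    using a that by (simp add: defining_system_def)
  have c0: "b [c] = 0"
    using c by (simp add: cocycles_def)
  have upper': "?a' \<in> strictly_upper m"
    using upper by (auto simp: strictly_upper_def multiply_by_def)
  have cocycle: "a i (Suc i) \<in> cocycles b" if "i < m" for i
    using flat [of i "Suc i"] that \<open>m \<ge> 2\<close> by (cases i) (auto simp: curvature_Suc cocycles_def)
  have flat': "curvature b ?a' i j = 0" if "i < j" "j \<le> m" "(i, j) \<noteq> (0, m)" for i j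
    using that curvature_multiply_by_left [of i j m c a] flat [of i j]
      curvature_multiply_by_last [OF c0, of i m a] flat
    by (cases "j = m") auto
  have "\<alpha>' i = coh_class b (?a' (i - 1) i)" if i: "i \<in> {1..m}" for i
  proof (cases "i = m")
    case False
    then have "a (i - 1) i \<in> cocycles b"
      using i cocycle [of "i - 1"] by auto
    then show ?thesis
      using i False by (simp add: \<alpha>'_def \<alpha> coh_bar_coh_class multiply_by_def)
  next
    case True
    then obtain k where m: "m = Suc k"
      using i by (cases m) auto
    \<comment> \<open>Of the two paths from \<open>k\<close> to \<open>k + 2\<close>, the one that skips \<open>m\<close> has no entry in \<open>a\<close>.\<close>
    have "a k (Suc (Suc k)) = 0"
      using upper m by (simp add: strictly_upper_def)
    then have "?a' k m = b [a k m, c]"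
      by (simp add: multiply_by_def curvature_def sum_paths_snoc extend_by_def m b1_zero
          atLeastLessThanSuc)
    then show ?thesis
      using i True cocycle [of k] c by (simp add: \<alpha>'_def \<alpha> m coh_b2_coh_class)
  qed
  with flat' show "defining_system b m \<alpha>' ?a'"
    unfolding defining_system_iff_curvature [OF upper'] by blast
  have \<mu>: "\<mu> b m a = curvature b a 0 m" "\<mu> b m ?a' = curvature b ?a' 0 m"
    using upper upper' \<open>m \<ge> 2\<close> by (simp_all add: \<mu>_def boundary_eq_curvature)
  have closed: "\<mu> b m a \<in> cocycles b"
    using cocycle_curvature [of 0 m a] flat \<open>m \<ge> 2\<close> by (simp add: \<mu> cocycles_def)
  have "\<mu> b m ?a' = - b [\<mu> b m a, c]"
    using curvature_multiply_by_last [OF c0, of 0 m a] flat \<open>m \<ge> 2\<close> by (simp add: \<mu>)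
  then show "coh_class b (\<mu> b m ?a') =
      coh_uminus b (coh_b2 b (coh_class b (\<mu> b m a)) (coh_class b c))"
    using closed c by (simp add: coh_b2_coh_class coh_uminus_coh_class b2_cocycle)
qed

end

theorem theorem4p11:
  fixes scale :: "'k::field \<Rightarrow> 'a::ab_group_add \<Rightarrow> 'a"
    and gr :: "'g::Z_or_Z2 \<Rightarrow> 'a set"
    and b :: "'a list \<Rightarrow> 'a"
    and m :: nat
    and \<alpha> :: "nat \<Rightarrow> 'a set"
    and \<gamma> :: "'a set"
  assumes "a_infinity_algebra scale gr b"
    and "m \<ge> 2"
    and "\<forall>i\<in>{1..m}. \<alpha> i \<in> cohomology b"
    and "massey_defined b m \<alpha>"
    and "\<gamma> \<in> cohomology b"
  shows "let \<alpha>' = (\<lambda>i. if i < m then coh_bar gr b (\<alpha> i) else coh_b2 b (\<alpha> m) \<gamma>) in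
    massey_defined b m \<alpha>' \<and>
    (\<lambda>\<beta>. coh_uminus b (coh_b2 b \<beta> \<gamma>)) ` massey_product b m \<alpha> \<subseteq> massey_product b m \<alpha>'"
proof -
  interpret a_infinity_algebra scale gr b
    by (rule assms(1))
  obtain c where c: "c \<in> cocycles b" and \<gamma>: "\<gamma> = coh_class b c"
    using assms(5) by (auto simp: cohomology_def coh_class_def elim: quotientE)
  define \<alpha>' where "\<alpha>' = (\<lambda>i. if i < m then coh_bar gr b (\<alpha> i) else coh_b2 b (\<alpha> m) \<gamma>)"
  have system: "defining_system b m \<alpha>' (multiply_by c m a)"
    "coh_class b (\<mu> b m (multiply_by c m a)) = coh_uminus b (coh_b2 b (coh_class b (\<mu> b m a)) \<gamma>)"
    if "defining_system b m \<alpha> a" for a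
    using defining_system_multiply_by [OF \<open>m \<ge> 2\<close> that c] unfolding \<alpha>'_def \<gamma> by simp_all
  have "massey_defined b m \<alpha>'"
    using assms(4) system(1) unfolding massey_defined_def by blast
  moreover have "(\<lambda>\<beta>. coh_uminus b (coh_b2 b \<beta> \<gamma>)) ` massey_product b m \<alpha> \<subseteq> massey_product b m \<alpha>'"
    unfolding massey_product_def using system by (fastforce simp flip: system(2))
  ultimately show ?thesis
    unfolding Let_def \<alpha>'_def by blast
qed

end
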